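(* Let $L$ be a first-order language with equality whose signature contains only relation symbols, and let $T$ be a set of sentences of $L$ which is consistent under the classical inference rules of first-order logic with equality. Then $T$ has a model with nonempty underlying set.
   Context: The classical inference rules are those of a standard sound and complete sequent calculus for first-order logic with equality over nonempty structures; in particular they include the usual rule: from $\Gamma\Rightarrow\varphi[Y/X]$ infer $\Gamma\Rightarrow\exists X\varphi$, so that $\exists x_0[x_0=x_0]$ is derivable. Concretely one may take: $\Gamma\Rightarrow\varphi$ if $\varphi\in\Gamma$; $\Rightarrow X=X$; from $\Gamma\Rightarrow\varphi$ infer $\Gamma'\Rightarrow\varphi$ if $\Gamma\subset\Gamma'$; from $\Gamma,\psi\Rightarrow\varphi$ and $\Gamma,\neg\psi\Rightarrow\varphi$ infer $\Gamma\Rightarrow\varphi$; from $\Gamma,\neg\varphi\Rightarrow\psi$ and $\Gamma,\neg\varphi\Rightarrow\neg\psi$ infer $\Gamma\Rightarrow\varphi$; from $\Gamma,\varphi\Rightarrow\chi$ and $\Gamma,\psi\Rightarrow\chi$ infer $\Gamma,\varphi\vee\psi\Rightarrow\chi$; from $\Gamma\Rightarrow\varphi$ infer $\Gamma\Rightarrow\varphi\vee\psi$ and $\Gamma\Rightarrow\psi\vee\varphi$; from $\Gamma,\varphi[Y/X]\Rightarrow\psi$ infer $\Gamma,\exists X\varphi\Rightarrow\psi$ if $Y$ is not free in the conclusion sequent; from $\Gamma\Rightarrow\varphi[Y/X]$ infer $\Gamma\Rightarrow\exists X\varphi$; from $\Gamma\Rightarrow\varphi[Y/X]$ infer $\Gamma,Y=Y'\Rightarrow\varphi[Y'/X]$.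 Here $[Y/X]$ is capture-avoiding substitution and formulas are taken up to renaming of bound variables. $T$ proves $\varphi$ if $\Gamma\Rightarrow\varphi$ is derivable for some finite $\Gamma\subset T$; $T$ is consistent if for no formula $\psi$ does $T$ prove both $\psi$ and $\neg\psi$. Relation symbols of arity $0$ are allowed. Structures and satisfaction are the usual ones. *)

theory Defs
  imports Main
begin

(* A relational signature: L R = Some n means that R is an n-ary relation symbol of L.
   Partiality makes the empty signature available. *)
type_synonym 'r signature = "'r \<Rightarrow> nat option"

(* De Bruijn indices represent formulas up to renaming of bound variables: under k
   quantifiers, index i < k is bound and index k + n is the free variable x_n. *)
datatype 'r fm =
    Eq nat nat
  | Rel 'r "nat list"
  | Neg "'r fm"
  | Or "'r fm" "'r fm"
  | Exists "'r fm"

primrec formula :: "'r signature \<Rightarrow> 'r fm \<Rightarrow> bool" where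
  "formula L (Eq x y) \<longleftrightarrow> True"
| "formula L (Rel R xs) \<longleftrightarrow> L R = Some (length xs)"
| "formula L (Neg p) \<longleftrightarrow> formula L p"
| "formula L (Or p q) \<longleftrightarrow> formula L p \<and> formula L q"
| "formula L (Exists p) \<longleftrightarrow> formula L p"

primrec free :: "'r fm \<Rightarrow> nat set" where
  "free (Eq x y) = {x, y}"
| "free (Rel R xs) = set xs"
| "free (Neg p) = free p"
| "free (Or p q) = free p \<union> free q"
| "free (Exists p) = {n. Suc n \<in> free p}"

definition sentence :: "'r signature \<Rightarrow> 'r fm \<Rightarrow> bool" where
  "sentence L p \<longleftrightarrow> formula L p \<and> free p = {}"

primrec rename :: "(nat \<Rightarrow> nat) \<Rightarrow> 'r fm \<Rightarrow> 'r fm" where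
  "rename f (Eq x y) = Eq (f x) (f y)"
| "rename f (Rel R xs) = Rel R (map f xs)"
| "rename f (Neg p) = Neg (rename f p)"
| "rename f (Or p q) = Or (rename f p) (rename f q)"
| "rename f (Exists p) = Exists (rename (case_nat 0 (\<lambda>n. Suc (f n))) p)"

(* If Exists p represents "exists X phi", then inst p y represents phi[Y/X] for Y = x_y:
   index 0 of p stands for X, and index Suc n for x_n. *)
definition inst :: "'r fm \<Rightarrow> nat \<Rightarrow> 'r fm" where
  "inst p y = rename (case_nat y (\<lambda>n. n)) p"

inductive derivable :: "'r signature \<Rightarrow> 'r fm set \<Rightarrow> 'r fm \<Rightarrow> bool"
  for L :: "'r signature" where
  assm: "finite G \<Longrightarrow> \<forall>q\<in>G. formula L q \<Longrightarrow> p \<in> G \<Longrightarrow> derivable L G p"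
| eq_refl: "derivable L {} (Eq x x)"
| weaken: "derivable L G p \<Longrightarrow> G \<subseteq> G' \<Longrightarrow> finite G' \<Longrightarrow> \<forall>q\<in>G'. formula L q \<Longrightarrow> derivable L G' p"
| by_cases: "derivable L (insert q G) p \<Longrightarrow> derivable L (insert (Neg q) G) p \<Longrightarrow> derivable L G p"
| contradiction: "derivable L (insert (Neg p) G) q \<Longrightarrow> derivable L (insert (Neg p) G) (Neg q) \<Longrightarrow>
    derivable L G p"
| or_left: "derivable L (insert p G) r \<Longrightarrow> derivable L (insert q G) r \<Longrightarrow>
    derivable L (insert (Or p q) G) r"
| or_right1: "derivable L G p \<Longrightarrow> formula L q \<Longrightarrow> derivable L G (Or p q)"
| or_right2: "derivable L G p \<Longrightarrow> formula L q \<Longrightarrow> derivable L G (Or q p)"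
| ex_left: "derivable L (insert (inst p y) G) q \<Longrightarrow>
    \<forall>r \<in> insert (Exists p) (insert q G). y \<notin> free r \<Longrightarrow> derivable L (insert (Exists p) G) q"
| ex_right: "derivable L G (inst p y) \<Longrightarrow> derivable L G (Exists p)"
| eq_subst: "derivable L G (inst p y) \<Longrightarrow> derivable L (insert (Eq y y') G) (inst p y')"

lemma formula_rename: "formula L (rename f p) \<longleftrightarrow> formula L p"
  by (induction p arbitrary: f) auto

(* The side conditions above suffice to keep derivations inside finite sequents over L. *)
lemma derivable_sequent:
  assumes "derivable L G p"
  shows "finite G \<and> (\<forall>q\<in>insert p G. formula L q)"
  using assms by induction (auto simp: inst_def formula_rename)

definition proves :: "'r signature \<Rightarrow> 'r fm set \<Rightarrow> 'r fm \<Rightarrow> bool" where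
  "proves L T p \<longleftrightarrow> (\<exists>G. finite G \<and> G \<subseteq> T \<and> derivable L G p)"

definition consistent :: "'r signature \<Rightarrow> 'r fm set \<Rightarrow> bool" where
  "consistent L T \<longleftrightarrow> \<not> (\<exists>p. formula L p \<and> proves L T p \<and> proves L T (Neg p))"

record ('r, 'm) struct =
  carrier :: "'m set"
  interp :: "'r \<Rightarrow> 'm list set"

definition is_structure :: "'r signature \<Rightarrow> ('r, 'm) struct \<Rightarrow> bool" where
  "is_structure L M \<longleftrightarrow>
    (\<forall>R n. L R = Some n \<longrightarrow> interp M R \<subseteq> {as. length as = n \<and> set as \<subseteq> carrier M})"

primrec sat :: "('r, 'm) struct \<Rightarrow> (nat \<Rightarrow> 'm) \<Rightarrow> 'r fm \<Rightarrow> bool" where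
  "sat M e (Eq x y) \<longleftrightarrow> e x = e y"
| "sat M e (Rel R xs) \<longleftrightarrow> map e xs \<in> interp M R"
| "sat M e (Neg p) \<longleftrightarrow> \<not> sat M e p"
| "sat M e (Or p q) \<longleftrightarrow> sat M e p \<or> sat M e q"
| "sat M e (Exists p) \<longleftrightarrow> (\<exists>a\<in>carrier M. sat M (case_nat a e) p)"

(* T is a set of sentences, whose truth does not depend on the assignment e; leaving e
   unrestricted keeps the definition meaningful for an empty carrier.
   HOL cannot quantify over the universe type 'm. A consistent T has a model of cardinality
   at most that of the set of L-formulas, so the universe type 'r fm set is large enough. *)
definition is_model :: "'r signature \<Rightarrow> ('r, 'm) struct \<Rightarrow> 'r fm set \<Rightarrow> bool" where
  "is_model L M T \<longleftrightarrow> is_structure L M \<and> (\<forall>p\<in>T. \<forall>e. sat M e p)"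

end

theory Submission
  imports Defs
begin

text \<open>
  This is Henkin's argument, arranged so that the language need not be extended, even when it
  is uncountable and so has more formulas than there are variables to serve as witnesses.

  The names of the objects of the model are the formulas themselves. A formula \<open>p\<close> together with
  an assignment \<open>s\<close> of names to the variables is a statement about names. A map \<open>g\<close> from names to
  variables realizes it as the ordinary formula \<open>rename (g \<circ> s) p\<close>, and a set of statements
  counts as consistent if each of its finite subsets is realized, by some \<open>g\<close>, as a set of
  formulas that does not derive a contradiction. A finite derivation mentions finitely many
  names, so countably many variables suffice here. Since a valid inference about names is valid
  under every \<open>g\<close>, a maximal consistent set of statements is closed under derivation.

  The name \<open>wit p ts\<close> stands for a witness of \<open>Exists p\<close> with parameters \<open>ts\<close>. It is larger than
  each of its parameters, so in a finite set of Henkin axioms, realized by an injective \<open>g\<close>, the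
  largest witness is a fresh variable for the other axioms, and the rule for \<open>Exists\<close> on the left
  removes its axiom (\<open>henkin_axioms_consistent\<close>). Zorn's lemma extends \<open>T\<close> and all the Henkin
  axioms to a maximal consistent set (\<open>complete_extension\<close>). Names modulo provable equality
  form a structure in which exactly the statements of that set hold (\<open>sat_term_model\<close>).
\<close>

section \<open>Renaming of variables\<close>

lemma rename_cong:
  "(\<And>n. n \<in> free p \<Longrightarrow> f n = h n) \<Longrightarrow> rename f p = rename h p"
proof (induction p arbitrary: f h)
  case (Neg p)
  have "rename f p = rename h p" by (rule Neg.IH) (simp add: Neg.prems)
  then show ?case by simp
next
  case (Or p q)
  have "rename f p = rename h p" by (rule Or.IH(1)) (simp add: Or.prems)
  moreover have "rename f q = rename h q" by (rule Or.IH(2)) (simp add: Or.prems)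
  ultimately show ?case by simp
next
  case (Exists p)
  have "rename (case_nat 0 (\<lambda>n. Suc (f n))) p = rename (case_nat 0 (\<lambda>n. Suc (h n))) p"
    using Exists.prems by (intro Exists.IH) (auto split: nat.splits)
  then show ?case by simp
qed simp_all

lemma rename_rename: "rename f (rename h p) = rename (f \<circ> h) p"
proof (induction p arbitrary: f h)
  case (Exists p)
  show ?case
    unfolding rename.simps Exists.IH by (auto intro!: rename_cong split: nat.splits)
qed simp_all

lemma rename_ident: "rename (\<lambda>n. n) p = p"
proof (induction p)
  case (Exists p)
  have "case_nat 0 Suc = (\<lambda>n. n)"
    by (auto split: nat.splits)
  with Exists show ?case by simp
qed (auto simp: map_idI)

lemma free_rename: "free (rename f p) = f ` free p"
proof (induction p arbitrary: f)
  case (Exists p)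
  have "Suc n \<in> case_nat 0 (\<lambda>n. Suc (f n)) ` free p \<longleftrightarrow> n \<in> f ` free (Exists p)" for n
  proof
    assume "Suc n \<in> case_nat 0 (\<lambda>n. Suc (f n)) ` free p"
    then obtain k where "k \<in> free p" "Suc n = case_nat 0 (\<lambda>n. Suc (f n)) k" by blast
    then show "n \<in> f ` free (Exists p)" by (cases k) auto
  next
    assume "n \<in> f ` free (Exists p)"
    then obtain m where "Suc m \<in> free p" "n = f m" by auto
    then show "Suc n \<in> case_nat 0 (\<lambda>n. Suc (f n)) ` free p"
      by (intro image_eqI[of _ _ "Suc m"]) simp_all
  qed
  then show ?case by (simp add: Exists set_eq_iff)
qed (simp_all add: image_Un)

lemma finite_free: "finite (free p)"
proof (induction p)
  case (Exists p)
  have "free (Exists p) = Suc -` free p" by auto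
  with Exists show ?case by (simp add: finite_vimageI)
qed auto

lemma rename_sentence: "sentence L p \<Longrightarrow> rename f p = p"
  by (metis empty_iff rename_cong rename_ident sentence_def)

lemma inst_rename:
  "inst (rename (case_nat 0 (\<lambda>n. Suc (f n))) p) y = rename (case_nat y f) p"
  unfolding inst_def rename_rename by (rule rename_cong) (auto split: nat.splits)

lemma free_inst: "free (inst p y) \<subseteq> insert y (free (Exists p))"
  by (auto simp: inst_def free_rename split: nat.splits)

lemma sat_cong:
  "(\<And>n. n \<in> free p \<Longrightarrow> e n = e' n) \<Longrightarrow> sat M e p \<longleftrightarrow> sat M e' p"
proof (induction p arbitrary: e e')
  case (Rel R xs)
  then have "map e xs = map e' xs" by simp
  then show ?case by (simp only: sat.simps)
next
  case (Neg p)
  have "sat M e p = sat M e' p" by (rule Neg.IH) (simp add: Neg.prems)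
  then show ?case by simp
next
  case (Or p q)
  have "sat M e p = sat M e' p" by (rule Or.IH(1)) (simp add: Or.prems)
  moreover have "sat M e q = sat M e' q" by (rule Or.IH(2)) (simp add: Or.prems)
  ultimately show ?case by simp
next
  case (Exists p)
  have "sat M (case_nat a e) p \<longleftrightarrow> sat M (case_nat a e') p" for a
    using Exists.prems by (intro Exists.IH) (auto split: nat.splits)
  then show ?case by simp
qed simp

section \<open>Derived rules\<close>

lemma derivable_finite: "derivable L G p \<Longrightarrow> finite G"
  using derivable_sequent by blast

lemma derivable_formula: "derivable L G p \<Longrightarrow> formula L p"
  using derivable_sequent by blast

lemma derivable_formulas: "derivable L G p \<Longrightarrow> q \<in> G \<Longrightarrow> formula L q"
  using derivable_sequent by blast

lemma assumption_insert:
  "finite G \<Longrightarrow> \<forall>q\<in>G. formula L q \<Longrightarrow> formula L p \<Longrightarrow> derivable L (insert p G) p"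
  by (rule derivable.assm) auto

lemma weaken_insert: "derivable L G p \<Longrightarrow> formula L q \<Longrightarrow> derivable L (insert q G) p"
  by (rule derivable.weaken) (auto dest: derivable_finite derivable_formulas)

lemma ex_falso:
  assumes "derivable L G q" "derivable L G (Neg q)" "formula L p"
  shows "derivable L G p"
  by (rule derivable.contradiction[of L p G q]) (use assms in \<open>auto intro: weaken_insert\<close>)

lemma cut:
  assumes q: "derivable L G q" and p: "derivable L (insert q G) p"
  shows "derivable L G p"
proof (rule derivable.by_cases[OF p])
  have G: "finite G" "\<forall>r\<in>G. formula L r" "formula L q"
    using q derivable_sequent by blast+
  show "derivable L (insert (Neg q) G) p"
    by (rule ex_falso[of L _ q])
       (use q G derivable_formula[OF p] in \<open>auto intro: weaken_insert assumption_insert\<close>)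
qed

lemma disjunctive_syllogism:
  assumes "derivable L G (Or (Neg q) r)" "derivable L G q"
  shows "derivable L G r"
proof -
  have G: "finite G" "\<forall>p\<in>G. formula L p" "formula L q" "formula L r"
    using assms derivable_sequent by fastforce+
  have "derivable L (insert (Neg q) G) r"
    by (rule ex_falso[of L _ q]) (use G assms in \<open>auto intro: weaken_insert assumption_insert\<close>)
  then have "derivable L (insert (Or (Neg q) r) G) r"
    by (rule derivable.or_left) (use G in \<open>auto intro: assumption_insert\<close>)
  with assms(1) show ?thesis by (rule cut)
qed

lemma refl_derivable:
  "finite G \<Longrightarrow> \<forall>q\<in>G. formula L q \<Longrightarrow> derivable L G (Eq x x)"
  by (rule derivable.weaken[OF derivable.eq_refl]) auto

lemma eq_subst_derivable:
  assumes "derivable L G (Eq y y')" "derivable L G (inst p y)"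
  shows "derivable L G (inst p y')"
  by (rule cut[OF assms(1) derivable.eq_subst[OF assms(2)]])

lemma eq_sym_derivable:
  assumes "derivable L G (Eq x y)" shows "derivable L G (Eq y x)"
proof -
  have "derivable L G (inst (Eq 0 (Suc x)) x)"
    using assms by (auto simp: inst_def intro: refl_derivable dest: derivable_finite derivable_formulas)
  from eq_subst_derivable[OF assms this] show ?thesis by (simp add: inst_def)
qed

lemma eq_trans_derivable:
  assumes "derivable L G (Eq x y)" "derivable L G (Eq y z)" shows "derivable L G (Eq x z)"
  using eq_subst_derivable[OF assms(2), of "Eq (Suc x) 0"] assms(1) by (simp add: inst_def)

text \<open>The arguments are replaced one at a time, from the left; \<open>us\<close> is the part already done.\<close>

lemma rel_cong_derivable:
  assumes "list_all2 (\<lambda>a b. derivable L G (Eq a b)) as bs" "derivable L G (Rel R (us @ as))"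
  shows "derivable L G (Rel R (us @ bs))"
  using assms
proof (induction arbitrary: us rule: list_all2_induct)
  case (Cons a as b bs)
  let ?p = "Rel R (map Suc us @ 0 # map Suc as)"
  have inst: "inst ?p c = Rel R (us @ c # as)" for c
    by (simp add: inst_def comp_def)
  have "derivable L G (Rel R ((us @ [b]) @ as))"
    using eq_subst_derivable[OF Cons.hyps(1), of ?p] Cons.prems by (simp add: inst)
  from Cons.IH[OF this] show ?case by simp
qed simp

text \<open>
  The contradiction must be a closed formula, because the rule for \<open>Exists\<close> on the left requires
  its variable to be fresh for the conclusion as well.
\<close>

abbreviation falsum :: "'r fm" where
  "falsum \<equiv> Neg (Exists (Eq 0 0))"

lemma verum_derivable:
  assumes "finite G" "\<forall>q\<in>G. formula L q"
  shows "derivable L G (Exists (Eq 0 0))"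
  by (rule derivable.ex_right[of _ _ _ 0]) (use assms in \<open>simp add: inst_def refl_derivable\<close>)

lemma falsum_elim:
  assumes "derivable L G falsum" "formula L p"
  shows "derivable L G p"
  by (rule ex_falso[OF verum_derivable])
     (use assms in \<open>auto dest: derivable_finite derivable_formulas\<close>)

lemma consistent_not_falsum:
  assumes "consistent L T" "G \<subseteq> T" shows "\<not> derivable L G falsum"
proof
  assume f: "derivable L G falsum"
  then have "derivable L G (Exists (Eq 0 0))"
    by (rule falsum_elim) simp
  with f assms show False
    unfolding consistent_def proves_def by (metis derivable_finite derivable_formula)
qed

text \<open>
  A Henkin axiom with a fresh witness is conservative: \<open>G\<close> refutes the instance, hence
  also \<open>Exists p\<close>, since the witness is fresh; and it refutes \<open>Neg (Exists p)\<close>.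
\<close>

lemma remove_henkin_axiom:
  assumes falsum: "derivable L (insert (Or (Neg (Exists p)) (inst p y)) G) falsum"
    and fresh: "\<forall>r\<in>insert (Exists p) G. y \<notin> free r"
  shows "derivable L G falsum"
proof -
  let ?h = "Or (Neg (Exists p)) (inst p y)"
  have fin: "finite G" and form: "\<forall>q\<in>G. formula L q"
    and p: "formula L p" "formula L (inst p y)"
    using derivable_sequent[OF falsum] by auto
  have from_axiom: "derivable L (insert q G) falsum"
    if "derivable L (insert q G) ?h" for q
  proof (rule cut[OF that])
    have "formula L q" using that derivable_formulas by blast
    with falsum show "derivable L (insert ?h (insert q G)) falsum"
      by (subst insert_commute) (rule weaken_insert)
  qed
  have "derivable L (insert (inst p y) G) falsum"
    by (rule from_axiom, rule derivable.or_right2) (use fin form p in \<open>auto intro: assumption_insert\<close>)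
  then have "derivable L (insert (Exists p) G) falsum"
    by (rule derivable.ex_left) (use fresh in auto)
  moreover have "derivable L (insert (Neg (Exists p)) G) falsum"
    by (rule from_axiom, rule derivable.or_right1) (use fin form p in \<open>auto intro: assumption_insert\<close>)
  ultimately show ?thesis by (rule derivable.by_cases)
qed

section \<open>Statements about names\<close>

type_synonym 'r statement = "'r fm \<times> (nat \<Rightarrow> 'r fm)"

definition realize :: "('r fm \<Rightarrow> nat) \<Rightarrow> 'r statement \<Rightarrow> 'r fm" where
  "realize g a = rename (g \<circ> snd a) (fst a)"

text \<open>
  With \<open>\<exists>g\<close> here, an inconsistent set has a finite subset that is refuted under every \<open>g\<close>. Two
  such refutations can be combined under the same \<open>g\<close>, with no need to rename derivations. That
  a non-injective \<open>g\<close> may identify names does no harm: it only makes refutation easier.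
\<close>

definition named_consistent :: "'r signature \<Rightarrow> 'r statement set \<Rightarrow> bool" where
  "named_consistent L S \<longleftrightarrow> (\<forall>D. finite D \<and> D \<subseteq> S \<longrightarrow> (\<exists>g. \<not> derivable L (realize g ` D) falsum))"

text \<open>
  \<open>Exists p\<close> is not a disjunction, so the end of the list \<open>ts\<close> can be read off from the formula
  and the coding is injective.
\<close>

definition wit :: "'r fm \<Rightarrow> 'r fm list \<Rightarrow> 'r fm" where
  "wit p ts = foldr Or ts (Exists p)"

lemma wit_inject: "wit p ts = wit q us \<longleftrightarrow> p = q \<and> ts = us"
proof (induction ts arbitrary: us)
  case Nil
  show ?case by (cases us) (auto simp: wit_def)
next
  case (Cons t ts)
  then show ?case by (cases us) (auto simp: wit_def)
qed

lemma size_wit: "t \<in> set ts \<Longrightarrow> size t < size (wit p ts)"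
  by (induction ts) (auto simp: wit_def)

text \<open>
  The axiom says that \<open>Exists p\<close> implies \<open>p\<close> of the witness. Since index 0 is assigned the witness,
  the parameters in \<open>Exists p\<close> move up by one.
\<close>

definition henkin :: "'r fm \<Rightarrow> 'r fm list \<Rightarrow> 'r statement" where
  "henkin p ts = (Or (Neg (rename Suc (Exists p))) p, case_nat (wit p ts) (nth ts))"

definition henkin_axioms :: "'r signature \<Rightarrow> 'r statement set" where
  "henkin_axioms L = {henkin p ts |p ts. formula L p \<and> free (Exists p) \<subseteq> {..<length ts}}"

lemma comp_case_nat: "f \<circ> case_nat a e = case_nat (f a) (f \<circ> e)"
  by (auto split: nat.splits)

lemma realize_henkin:
  fixes g p ts
  defines "q \<equiv> rename (case_nat 0 (\<lambda>n. Suc (g (ts ! n)))) p"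
  shows "realize g (henkin p ts) = Or (Neg (Exists q)) (inst q (g (wit p ts)))"
proof -
  have "rename (g \<circ> case_nat (wit p ts) (nth ts)) (rename Suc (Exists p)) = Exists q"
    unfolding rename_rename q_def by (simp add: comp_def)
  moreover have "rename (g \<circ> case_nat (wit p ts) (nth ts)) p = inst q (g (wit p ts))"
    unfolding q_def inst_rename comp_case_nat by (simp add: comp_def)
  ultimately show ?thesis
    by (simp add: realize_def henkin_def)
qed

text \<open>
  Under an injective \<open>g\<close> the axioms are removed one at a time, the one with the largest witness
  first: every other name is a parameter, hence smaller, or a different witness, so \<open>g\<close> sends
  the largest witness to a variable that does not occur elsewhere.
\<close>

lemma henkin_axioms_consistent:
  fixes L :: "'r signature" and T :: "'r fm set"
  assumes T: "\<forall>p\<in>T. sentence L p" "consistent L T"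
  shows "named_consistent L (T \<times> UNIV \<union> henkin_axioms L)"
  unfolding named_consistent_def
proof (intro allI impI, elim conjE)
  fix D assume D: "finite D" "D \<subseteq> T \<times> UNIV \<union> henkin_axioms L"
  define G where "G = fst ` (D \<inter> T \<times> UNIV)"
  have G: "G \<subseteq> T" using D by (auto simp: G_def)
  define I :: "('r fm \<times> 'r fm list) set" where "I = {(p, ts). formula L p \<and> free (Exists p) \<subseteq> {..<length ts}}"
  have "D \<inter> henkin_axioms L \<subseteq> case_prod henkin ` I"
    by (auto simp: henkin_axioms_def I_def)
  then obtain W where W: "W \<subseteq> I" "finite W" "D \<inter> henkin_axioms L = case_prod henkin ` W"
    using finite_subset_image[of "D \<inter> henkin_axioms L"] D(1) by (metis finite_Int)
  define A where "A = (\<Union>(p, ts)\<in>W. insert (wit p ts) (set ts))"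
  have "finite A" using W by (auto simp: A_def)
  then obtain g :: "'r fm \<Rightarrow> nat" where g: "inj_on g A"
    using finite_imp_inj_to_nat_seg by blast
  have no_falsum: "V \<subseteq> W \<Longrightarrow> \<not> derivable L (realize g ` case_prod henkin ` V \<union> G) falsum"
    if "finite V" for V
    using that
  proof (induction V rule: finite_ranking_induct[where f = "\<lambda>(p, ts). size (wit p ts)"])
    case empty
    then show ?case using consistent_not_falsum[OF T(2) G] by simp
  next
    case (insert v V)
    obtain p ts where v: "v = (p, ts)" by (cases v)
    show ?case
    proof (cases "v \<in> V")
      case True
      with insert show ?thesis by (simp add: insert_absorb)
    next
      case False
      let ?q = "rename (case_nat 0 (\<lambda>n. Suc (g (ts ! n)))) p"
      let ?y = "g (wit p ts)"
      have w: "wit p ts \<in> A" using insert.prems v by (auto simp: A_def)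
      have names: "c \<in> A \<Longrightarrow> c \<noteq> wit p ts \<Longrightarrow> g c \<noteq> ?y" for c
        using g w by (auto dest: inj_onD)
      have free_ex: "free (Exists (rename (case_nat 0 (\<lambda>n. Suc (g (us ! n)))) r)) \<subseteq> g ` set us"
        if "(r, us) \<in> W" for r us
      proof -
        have "free (rename (\<lambda>n. g (us ! n)) (Exists r)) \<subseteq> g ` set us"
          using that W(1) unfolding free_rename I_def by fastforce
        then show ?thesis by simp
      qed
      have small: "?y \<notin> g ` set us" if "(r, us) \<in> insert v V" for r us
      proof
        assume "?y \<in> g ` set us"
        then obtain t where t: "t \<in> set us" "g t = ?y" by auto
        have "size t < size (wit p ts)"
          using size_wit[OF t(1), of r] insert.hyps(2)[of "(r, us)"] that v by auto
        moreover have "t \<in> A" using that t(1) insert.prems by (auto simp: A_def)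
        ultimately show False using names t(2) by blast
      qed
      have fresh_V: "?y \<notin> free (realize g (henkin r us))" if "(r, us) \<in> V" for r us
      proof -
        have W': "(r, us) \<in> W" using that insert.prems by auto
        have "wit r us \<noteq> wit p ts" using that False v by (auto simp: wit_inject)
        moreover have "wit r us \<in> A" using W' by (auto simp: A_def)
        ultimately have "g (wit r us) \<noteq> ?y" by (rule names[rotated])
        moreover have "?y \<notin> g ` set us" using small that by blast
        moreover let ?r = "rename (case_nat 0 (\<lambda>n. Suc (g (us ! n)))) r"
        have "free (realize g (henkin r us)) = free (Exists ?r) \<union> free (inst ?r (g (wit r us)))"
          by (simp only: realize_henkin free.simps(3,4))
        then have "free (realize g (henkin r us)) \<subseteq> insert (g (wit r us)) (g ` set us)"
          using free_ex[OF W'] free_inst[of ?r "g (wit r us)"] by (simp only:) blast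
        ultimately show ?thesis by auto
      qed
      have fresh_G: "?y \<notin> free r" if "r \<in> G" for r
        using that G T(1) by (auto simp: sentence_def)
      have fresh_q: "?y \<notin> free (Exists ?q)"
        using free_ex[of p ts] small[of p ts] insert.prems v by blast
      have "realize g (henkin p ts) = Or (Neg (Exists ?q)) (inst ?q ?y)"
        by (rule realize_henkin)
      moreover have "\<forall>r\<in>insert (Exists ?q) (realize g ` case_prod henkin ` V \<union> G). ?y \<notin> free r"
        using fresh_V fresh_G fresh_q by auto
      ultimately show ?thesis
        using remove_henkin_axiom insert.IH insert.prems v by fastforce
    qed
  qed
  have "realize g ` D = realize g ` (D \<inter> henkin_axioms L) \<union> realize g ` (D \<inter> T \<times> UNIV)"
    using D by blast
  also have "realize g ` (D \<inter> T \<times> UNIV) = G"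
    using T(1) by (force simp: G_def realize_def rename_sentence)
  finally have eq: "realize g ` D = realize g ` case_prod henkin ` W \<union> G"
    unfolding W(3) .
  show "\<exists>g. \<not> derivable L (realize g ` D) falsum"
    using no_falsum[OF W(2) subset_refl] unfolding eq[symmetric] by blast
qed

section \<open>Maximal consistent sets of statements\<close>

locale complete_theory =
  fixes L :: "'r signature" and S :: "'r statement set"
  assumes consistent: "named_consistent L S"
    and complete: "formula L p \<Longrightarrow> (p, s) \<in> S \<or> (Neg p, s) \<in> S"
    and henkin_axioms: "henkin_axioms L \<subseteq> S"

lemma complete_extension:
  assumes cons: "named_consistent L S0" and henkin: "henkin_axioms L \<subseteq> S0"
  obtains S where "S0 \<subseteq> S" "complete_theory L S"
proof -
  let ?C = "{S. S0 \<subseteq> S \<and> named_consistent L S}"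
  have "\<exists>M\<in>?C. \<forall>X\<in>?C. M \<subseteq> X \<longrightarrow> X = M"
  proof (rule subset_Zorn_nonempty)
    show "?C \<noteq> {}" using cons by auto
    fix C assume C: "C \<noteq> {}" "subset.chain ?C C"
    have "named_consistent L (\<Union>C)"
      unfolding named_consistent_def
    proof (intro allI impI, elim conjE)
      fix D assume "finite D" "D \<subseteq> \<Union>C"
      then obtain X where "X \<in> C" "D \<subseteq> X"
        using finite_subset_Union_chain C by metis
      then show "\<exists>g. \<not> derivable L (realize g ` D) falsum"
        using C(2) \<open>finite D\<close> by (auto simp: subset.chain_def named_consistent_def)
    qed
    moreover have "S0 \<subseteq> \<Union>C" using C by (fastforce simp: subset.chain_def)
    ultimately show "\<Union>C \<in> ?C" by simp
  qed
  then obtain S where S: "S0 \<subseteq> S" "named_consistent L S"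
    and maximal: "\<And>X. named_consistent L X \<Longrightarrow> S \<subseteq> X \<Longrightarrow> X = S"
    by (smt (verit) mem_Collect_eq order_trans)
  have refuted: "\<exists>D. finite D \<and> D \<subseteq> S \<and> (\<forall>g. derivable L (insert (realize g a) (realize g ` D)) falsum)"
    if "formula L (fst a)" "a \<notin> S" for a
  proof -
    have "\<not> named_consistent L (insert a S)"
      using maximal[of "insert a S"] that(2) by auto
    then obtain D where D: "finite D" "D \<subseteq> insert a S" "\<forall>g. derivable L (realize g ` D) falsum"
      by (auto simp: named_consistent_def)
    have "derivable L (insert (realize g a) (realize g ` (D - {a}))) falsum" for g
    proof (rule derivable.weaken)
      show "derivable L (realize g ` D) falsum" using D by simp
      then show "\<forall>q\<in>insert (realize g a) (realize g ` (D - {a})). formula L q"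
        using that(1) by (auto simp: realize_def formula_rename dest: derivable_formulas)
    qed (use D in auto)
    with D show ?thesis by (intro exI[of _ "D - {a}"]) auto
  qed
  have "(p, s) \<in> S \<or> (Neg p, s) \<in> S" if p: "formula L p" for p s
  proof (rule ccontr)
    assume "\<not> ((p, s) \<in> S \<or> (Neg p, s) \<in> S)"
    then obtain D E where D: "finite D" "D \<subseteq> S"
        "\<And>g. derivable L (insert (realize g (p, s)) (realize g ` D)) falsum"
      and E: "finite E" "E \<subseteq> S"
        "\<And>g. derivable L (insert (realize g (Neg p, s)) (realize g ` E)) falsum"
      using refuted[of "(p, s)"] refuted[of "(Neg p, s)"] p by auto
    have "derivable L (realize g ` (D \<union> E)) falsum" for g
    proof (rule derivable.by_cases)
      have f: "\<forall>q\<in>insert (realize g (p, s)) (insert (realize g (Neg p, s)) (realize g ` (D \<union> E))). formula L q"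
        using D(3)[of g] E(3)[of g] by (auto dest: derivable_formulas)
      show "derivable L (insert (realize g (p, s)) (realize g ` (D \<union> E))) falsum"
        by (rule derivable.weaken[OF D(3)[of g]]) (use D(1) E(1) f in auto)
      show "derivable L (insert (Neg (realize g (p, s))) (realize g ` (D \<union> E))) falsum"
        by (rule derivable.weaken[OF E(3)[of g]]) (use D(1) E(1) f in \<open>auto simp: realize_def\<close>)
    qed
    then show False
      using S(2) D E unfolding named_consistent_def by (metis finite_Un Un_subset_iff)
  qed
  then have "complete_theory L S"
    using S henkin by unfold_locales auto
  with S(1) show thesis by (rule that)
qed

context complete_theory
begin

text \<open>
  The derivation must exist for every \<open>g\<close>, because the consistency of \<open>D\<close> together with the
  negation of \<open>(p, s)\<close> provides only some unknown \<open>g\<close>.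
\<close>

lemma closed:
  assumes D: "finite D" "D \<subseteq> S" and p: "\<And>g. derivable L (realize g ` D) (realize g (p, s))"
  shows "(p, s) \<in> S"
proof (rule ccontr)
  assume "(p, s) \<notin> S"
  have f: "formula L p"
    using derivable_formula[OF p] by (simp add: realize_def formula_rename)
  then have "(Neg p, s) \<in> S" using complete \<open>(p, s) \<notin> S\<close> by blast
  with D obtain g where g: "\<not> derivable L (realize g ` insert (Neg p, s) D) falsum"
    using consistent unfolding named_consistent_def by (metis finite_insert insert_subset)
  let ?q = "realize g (p, s)"
  have G: "finite (realize g ` D)" "\<forall>q\<in>realize g ` D. formula L q"
    using derivable_sequent[OF p[of g]] by auto
  have q: "formula L ?q" using f by (simp add: realize_def formula_rename)
  have "derivable L (insert (Neg ?q) (realize g ` D)) falsum"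
  proof (rule ex_falso)
    show "derivable L (insert (Neg ?q) (realize g ` D)) ?q"
      by (rule weaken_insert[OF p]) (simp add: q)
    show "derivable L (insert (Neg ?q) (realize g ` D)) (Neg ?q)"
      by (rule assumption_insert[OF G]) (simp add: q)
  qed simp
  with g show False by (simp add: realize_def)
qed

lemma not_both: "\<not> ((p, s) \<in> S \<and> (Neg p, s) \<in> S)" if "formula L p"
proof
  assume S: "(p, s) \<in> S \<and> (Neg p, s) \<in> S"
  then obtain g where "\<not> derivable L (realize g ` {(p, s), (Neg p, s)}) falsum"
    using consistent unfolding named_consistent_def
    by (metis empty_subsetI finite.emptyI finite_insert insert_subset)
  moreover have "derivable L (realize g ` {(p, s), (Neg p, s)}) falsum"
    by (rule ex_falso[of L _ "realize g (p, s)"])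
       (use that in \<open>auto simp: realize_def formula_rename intro!: derivable.assm\<close>)
  ultimately show False by blast
qed

lemma Neg_iff: "formula L p \<Longrightarrow> (Neg p, s) \<in> S \<longleftrightarrow> (p, s) \<notin> S"
  using complete not_both by blast

lemma Or_iff:
  assumes "formula L p" "formula L q"
  shows "(Or p q, s) \<in> S \<longleftrightarrow> (p, s) \<in> S \<or> (q, s) \<in> S"
proof
  assume "(p, s) \<in> S \<or> (q, s) \<in> S"
  then show "(Or p q, s) \<in> S"
  proof
    assume "(p, s) \<in> S"
    with assms show ?thesis
      by (intro closed[of "{(p, s)}"])
         (auto simp: realize_def formula_rename intro!: derivable.assm derivable.or_right1)
  next
    assume "(q, s) \<in> S"
    with assms show ?thesis
      by (intro closed[of "{(q, s)}"])
         (auto simp: realize_def formula_rename intro!: derivable.assm derivable.or_right2)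
  qed
next
  assume or: "(Or p q, s) \<in> S"
  have "(q, s) \<in> S" if "(Neg p, s) \<in> S"
  proof (rule closed[of "{(Or p q, s), (Neg p, s)}"])
    fix g
    let ?p = "realize g (p, s)" and ?q = "realize g (q, s)"
    have f: "formula L ?p" "formula L ?q" using assms by (auto simp: realize_def formula_rename)
    have "derivable L (insert (Or ?p ?q) {Neg ?p}) ?q"
    proof (rule derivable.or_left)
      show "derivable L {?p, Neg ?p} ?q"
        by (rule ex_falso[of L _ ?p]) (use f in \<open>auto intro!: derivable.assm\<close>)
      show "derivable L {?q, Neg ?p} ?q"
        by (rule derivable.assm) (use f in auto)
    qed
    then show "derivable L (realize g ` {(Or p q, s), (Neg p, s)}) ?q"
      by (simp add: realize_def)
  qed (use or that in auto)
  then show "(p, s) \<in> S \<or> (q, s) \<in> S" using assms Neg_iff by blast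
qed

lemma Exists_iff:
  assumes p: "formula L p"
  shows "(Exists p, s) \<in> S \<longleftrightarrow> (\<exists>c. (p, case_nat c s) \<in> S)"
proof
  assume "\<exists>c. (p, case_nat c s) \<in> S"
  then obtain c where c: "(p, case_nat c s) \<in> S" by blast
  show "(Exists p, s) \<in> S"
  proof (rule closed[of "{(p, case_nat c s)}"])
    fix g
    let ?q = "rename (case_nat 0 (\<lambda>n. Suc (g (s n)))) p"
    have q: "realize g (p, case_nat c s) = inst ?q (g c)"
      by (simp add: realize_def inst_rename comp_case_nat) (simp add: comp_def)
    have "formula L (inst ?q (g c))" using p by (simp add: inst_def formula_rename)
    then have "derivable L {inst ?q (g c)} (Exists ?q)"
      by (intro derivable.ex_right[of _ _ _ "g c"] derivable.assm) auto
    with q show "derivable L (realize g ` {(p, case_nat c s)}) (realize g (Exists p, s))"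
      by (simp add: realize_def)
  qed (use c in auto)
next
  assume ex: "(Exists p, s) \<in> S"
  obtain N where N: "free (Exists p) \<subseteq> {..<N}"
    using finite_free[of "Exists p"] unfolding finite_nat_set_iff_bounded by auto
  define ts where "ts = map s [0..<N]"
  have "free (Exists p) \<subseteq> {..<length ts}" using N by (simp add: ts_def)
  then have h: "henkin p ts \<in> S"
    using henkin_axioms p unfolding henkin_axioms_def by blast
  have "(p, case_nat (wit p ts) s) \<in> S"
  proof (rule closed[of "{(Exists p, s), henkin p ts}"])
    fix g
    let ?q = "rename (case_nat 0 (\<lambda>n. Suc (g (s n)))) p"
    have "rename (case_nat 0 (\<lambda>n. Suc (g (ts ! n)))) p = ?q"
      using N by (intro rename_cong) (auto simp: ts_def subset_iff split: nat.splits)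
    then have hq: "realize g (henkin p ts) = Or (Neg (Exists ?q)) (inst ?q (g (wit p ts)))"
      using realize_henkin[of g p ts] by simp
    have f: "formula L ?q" "formula L (inst ?q (g (wit p ts)))"
      using p by (auto simp: inst_def formula_rename)
    have "derivable L {Exists ?q, Or (Neg (Exists ?q)) (inst ?q (g (wit p ts)))} (inst ?q (g (wit p ts)))"
      by (rule disjunctive_syllogism[of _ _ "Exists ?q"]) (use f in \<open>auto intro!: derivable.assm\<close>)
    moreover have "realize g (p, case_nat (wit p ts) s) = inst ?q (g (wit p ts))"
      by (simp add: realize_def inst_rename comp_case_nat) (simp add: comp_def)
    ultimately show "derivable L (realize g ` {(Exists p, s), henkin p ts})
        (realize g (p, case_nat (wit p ts) s))"
      using hq by (simp add: realize_def)
  qed (use ex h in auto)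
  then show "\<exists>c. (p, case_nat c s) \<in> S" by blast
qed

section \<open>The model of names\<close>

text \<open>
  Equality of two names is stated by one fixed formula under a varying assignment, which sends
  index 0 to \<open>c\<close> and index 1 to \<open>d\<close>. \<open>Eq_iff\<close> carries this over to all other
  ways of writing the same statement.
\<close>

definition equal :: "'r fm \<Rightarrow> 'r fm \<Rightarrow> bool" where
  "equal c d \<longleftrightarrow> (Eq 0 1, case_nat c (\<lambda>_. d)) \<in> S"

lemma Eq_iff: "(Eq x y, s) \<in> S \<longleftrightarrow> equal (s x) (s y)"
proof
  assume "(Eq x y, s) \<in> S"
  then show "equal (s x) (s y)"
    unfolding equal_def
    by (intro closed[of "{(Eq x y, s)}"]) (auto simp: realize_def intro!: derivable.assm)
next
  assume "equal (s x) (s y)"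
  then show "(Eq x y, s) \<in> S"
    unfolding equal_def
    by (intro closed[of "{(Eq 0 1, case_nat (s x) (\<lambda>_. s y))}"])
       (auto simp: realize_def intro!: derivable.assm)
qed

lemma equal_refl: "equal c c"
  unfolding equal_def by (rule closed[of "{}"]) (auto simp: realize_def intro: derivable.eq_refl)

lemma equal_sym: "equal c d \<Longrightarrow> equal d c"
  unfolding equal_def
  by (rule closed[of "{(Eq 0 1, case_nat c (\<lambda>_. d))}"])
     (auto simp: realize_def intro!: eq_sym_derivable[OF derivable.assm])

lemma equal_trans:
  assumes "equal c d" "equal d e"
  shows "equal c e"
  unfolding equal_def
proof (rule closed[of "{(Eq 0 1, case_nat c (\<lambda>_. d)), (Eq 0 1, case_nat d (\<lambda>_. e))}"])
  show "derivable L (realize g ` {(Eq 0 1, case_nat c (\<lambda>_. d)), (Eq 0 1, case_nat d (\<lambda>_. e))})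
      (realize g (Eq 0 1, case_nat c (\<lambda>_. e)))" for g
    by (auto simp: realize_def intro!: eq_trans_derivable[of _ _ "g c" "g d" "g e"] derivable.assm)
qed (use assms in \<open>auto simp: equal_def\<close>)

definition cls :: "'r fm \<Rightarrow> 'r fm set" where
  "cls c = {d. equal c d}"

lemma cls_eq_iff: "cls c = cls d \<longleftrightarrow> equal c d"
  unfolding cls_def using equal_refl equal_sym equal_trans by blast

text \<open>
  An element of a relation of the model can be written with many choices of names and variables;
  this makes the choice irrelevant, so that the relations of the model contain no more than
  they should.
\<close>

lemma Rel_cong:
  assumes R: "(Rel R xs, s) \<in> S" "L R = Some (length xs)"
    and eq: "map (cls \<circ> s) xs = map (cls \<circ> t) ys"
  shows "(Rel R ys, t) \<in> S"
proof -
  have eq': "list_all2 (\<lambda>x y. equal (s x) (t y)) xs ys"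
    using eq unfolding list.rel_eq[symmetric]
    by (simp add: list_all2_map1 list_all2_map2 cls_eq_iff)
  let ?E = "(\<lambda>(x, y). (Eq 0 1, case_nat (s x) (\<lambda>_. t y))) ` set (zip xs ys)"
  show ?thesis
  proof (rule closed[of "insert (Rel R xs, s) ?E"])
    show "insert (Rel R xs, s) ?E \<subseteq> S"
      using R(1) eq' by (auto simp: list_all2_iff equal_def)
    fix g
    let ?G = "realize g ` insert (Rel R xs, s) ?E"
    have f: "finite ?G" "\<forall>q\<in>?G. formula L q"
      using R(2) by (auto simp: realize_def)
    have "derivable L ?G (Eq (g (s x)) (g (t y)))" if "(x, y) \<in> set (zip xs ys)" for x y
      by (rule derivable.assm[OF f]) (use that in \<open>force simp: realize_def\<close>)
    then have "list_all2 (\<lambda>a b. derivable L ?G (Eq a b)) (map (g \<circ> s) xs) (map (g \<circ> t) ys)"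
      unfolding list_all2_map1 list_all2_map2 using eq' by (auto simp: list_all2_iff)
    moreover have "derivable L ?G (Rel R ([] @ map (g \<circ> s) xs))"
      by (rule derivable.assm[OF f]) (simp add: realize_def)
    ultimately have "derivable L ?G (Rel R ([] @ map (g \<circ> t) ys))"
      by (rule rel_cong_derivable)
    then show "derivable L ?G (realize g (Rel R ys, t))"
      by (simp add: realize_def)
  qed simp
qed

definition term_model :: "('r, 'r fm set) struct" where
  "term_model = \<lparr>carrier = range cls,
     interp = \<lambda>R. {map (cls \<circ> s) xs |s xs. L R = Some (length xs) \<and> (Rel R xs, s) \<in> S}\<rparr>"

lemma sat_term_model: "formula L p \<Longrightarrow> sat term_model (cls \<circ> s) p \<longleftrightarrow> (p, s) \<in> S"
proof (induction p arbitrary: s)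
  case (Eq x y)
  then show ?case by (simp add: Eq_iff cls_eq_iff)
next
  case (Rel R xs)
  have "sat term_model (cls \<circ> s) (Rel R xs) \<longleftrightarrow>
      (\<exists>t ys. map (cls \<circ> s) xs = map (cls \<circ> t) ys \<and> L R = Some (length ys) \<and> (Rel R ys, t) \<in> S)"
    by (simp add: term_model_def)
  with Rel show ?case using Rel_cong by (metis formula.simps(2))
next
  case (Exists p)
  have "sat term_model (cls \<circ> s) (Exists p) \<longleftrightarrow> (\<exists>c. sat term_model (cls \<circ> case_nat c s) p)"
    by (simp add: term_model_def comp_case_nat)
  with Exists show ?case by (simp only: Exists_iff formula.simps)
qed (auto simp: Neg_iff Or_iff)

lemma is_model_term_model:
  assumes "\<forall>p\<in>T. sentence L p" "T \<times> UNIV \<subseteq> S"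
  shows "is_model L term_model T"
  unfolding is_model_def
proof (intro conjI ballI allI)
  show "is_structure L term_model"
    by (auto simp: is_structure_def term_model_def)
  fix p and e :: "nat \<Rightarrow> 'r fm set" assume p: "p \<in> T"
  then have "sat term_model (cls \<circ> undefined) p"
    using assms by (subst sat_term_model) (auto simp: sentence_def)
  then show "sat term_model e p"
    using sat_cong[of p e "cls \<circ> undefined"] p assms(1) by (simp add: sentence_def)
qed

end

theorem mainTheorem3:
  fixes L :: "'r signature" and T :: "'r fm set"
  assumes "\<forall>p\<in>T. sentence L p"
    and "consistent L T"
  shows "\<exists>M :: ('r, 'r fm set) struct. is_model L M T \<and> carrier M \<noteq> {}"
proof -
  obtain S where S: "T \<times> UNIV \<union> henkin_axioms L \<subseteq> S" "complete_theory L S"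
    using complete_extension[OF henkin_axioms_consistent[OF assms]] by auto
  interpret complete_theory L S by fact
  have "is_model L term_model T"
    using is_model_term_model assms(1) S(1) by simp
  moreover have "carrier term_model \<noteq> {}"
    by (simp add: term_model_def)
  ultimately show ?thesis by blast
qed

end
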